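(* Let $\mathfrak B$ be a generalized model in the narrow sense with universe $\beta X$ whose interpretation is pseudo-principal on functional symbols, with principal submodel $\mathfrak A$ (universe $X$), and let $\mathfrak U=i(\mathfrak B)$. Let $\mathfrak V$ be a generalized model in the wide sense in the same signature with universe $Y$ carrying a compact Hausdorff topology (and with fixed topologies on $Y^{Y^n}$ and $\mathcal P(Y^n)$), let $h:X\to Y$, and suppose that for every $n$, the interpretation in $\mathfrak V$ takes all $n$-ary functional symbols to ultrafilters having limits in $RC_{h``X}(Y^n,Y)$ and all $n$-ary predicate symbols to ultrafilters having limits in $\{S\subseteq Y^n: S$ is right closed w.r.t. $h``X\}$. Then the following are equivalent: (i) $h$ is a homomorphism of $\mathfrak A$ into $\mathfrak V$; (ii) $\tilde h$ is a homomorphism of $\mathfrak U$ into $\mathfrak V$; (iii) $\tilde h$ is a homomorphism of $\widetilde{\mathfrak A}$ into $\mathfrak V$. If moreover the interpretation in $\mathfrak V$ takes $n$-ary predicate symbols to ultrafilters having limits in $\{S\subseteq Y^n:S$ is closed$\}$ (product topology on $Y^n$), then also (iv) $\tilde h$ is a homomorphism of $\mathfrak A^*$ into $\mathfrak V$ is equivalent to each of (i)–(iii).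
   Context: $\beta X$: ultrafilters on $X$, $X\subseteq\beta X$ via principal ultrafilters, standard compact Hausdorff topology; $(\forall^{\mathfrak u}x)\varphi$ means $\{x:\varphi\}\in\mathfrak u$. $\tilde h:\beta X\to Y$ is the unique continuous extension of $h$. For $f:X^n\to X$, $\tilde f(\mathfrak u_1,\dots,\mathfrak u_n)=\{A:(\forall^{\mathfrak u_1}x_1)\cdots(\forall^{\mathfrak u_n}x_n)f(x_1,\dots,x_n)\in A\}$; for $Q\subseteq X^n$, $\tilde Q=\{(\mathfrak u_i):(\forall^{\mathfrak u_1}x_1)\cdots(\forall^{\mathfrak u_n}x_n)(x_1,\dots,x_n)\in Q\}$, $Q^*=\{(\mathfrak u_i):\forall A_i\in\mathfrak u_i\ Q\cap(A_1\times\dots\times A_n)\ne\emptyset\}$; for an ordinary model $\mathfrak A=(X,F,\dots,R,\dots)$, $\widetilde{\mathfrak A}=(\beta X,\tilde F,\dots,\tilde R,\dots)$, $\mathfrak A^*=(\beta X,\tilde F,\dots,R^*,\dots)$. Narrow sense: interpretation $\imath$, $\imath(F)\in\beta(X^{X^n})$, $\imath(R)\in\beta\,\mathcal P(X^n)$; pseudo-principal on functional symbols: for all $F$ and $a_1,\dots,a_n\in X$, $\{A:(\forall^{\imath(F)}f)f(a_1,\dots,a_n)\in A\}$ is principal. $\mathrm{RC}_n$: maps $(\beta X)^n\to\beta X$ right continuous w.r.t. $X$ (continuous in the $i$-th argument whenever the first $i-1$ arguments lie in $X$), with topology of pointwise convergence on $X^n$; $\mathrm{RClop}_n$: subsets of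 $(\beta X)^n$ right clopen w.r.t. $X$, with topology of pointwise convergence on $X^n$ of characteristic functions (discrete $\{0,1\}$). $e$ on $\beta(X^{X^n})$, resp. $\beta\,\mathcal P(X^n)$: the unique continuous extension of $f\mapsto\tilde f$ into $\mathrm{RC}_n$, resp. $Q\mapsto\tilde Q$ into $\mathrm{RClop}_n$; $e(\mathfrak B)$ is the ordinary model on $\beta X$ with these values. When $\mathfrak B$ is pseudo-principal, $X$ is closed under the operations of $e(\mathfrak B)$ and the principal submodel is the submodel of $e(\mathfrak B)$ on $X$. $i(\mathfrak f)=\{B:\{f:\tilde f\in B\}\in\mathfrak f\}$, $i(\mathfrak r)=\{B:\{Q:\tilde Q\in B\}\in\mathfrak r\}$; $\mathfrak U=i(\mathfrak B)$ is the generalized model in the wide sense with universe $\beta X$ interpreting each symbol by $i$ of its $\mathfrak B$-interpretation, with limits taken in $\mathrm{RC}_n$ and $\mathrm{RClop}_n$. Wide sense: symbols interpreted by ultrafilters on $W^{W^n}$, $\mathcal P(W^n)$; a limit is the unique point of convergence; $\lim$ of the model interprets each symbol by the limit. For a topological $Z$, $A\subseteq Z$: $RC_A(Z^n,Z)$ are maps continuous in the $i$-th argument whenever the first $i-1$ arguments lie in $A$; a relation is right closed w.r.t. $A$ if all such sections are closed. Homomorphisms involving generalized models in the wide sense are homomorphisms of the corresponding limit models; ordinary models are identified with wide-sense models having the principal interpretation (whose limit is the model itself). *)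

theory Defs
  imports "HOL-Analysis.Analysis"
begin

section \<open>Ultrafilters and the space \<open>\<beta>X\<close>\<close>

typedef 'a beta =
  "{F :: 'a filter. F \<noteq> bot \<and> (\<forall>P. eventually P F \<or> eventually (\<lambda>x. \<not> P x) F)}"
  morphisms filter_of Abs_beta
proof
  show "principal {undefined :: 'a} \<in>
      {F. F \<noteq> bot \<and> (\<forall>P. eventually P F \<or> eventually (\<lambda>x. \<not> P x) F)}"
    by (simp add: eventually_principal principal_eq_bot_iff)
qed

setup_lifting type_definition_beta

lift_definition princ :: "'a \<Rightarrow> 'a beta" is "\<lambda>x. principal {x}"
  by (simp add: eventually_principal principal_eq_bot_iff)

lift_definition beta_map :: "('a \<Rightarrow> 'b) \<Rightarrow> 'a beta \<Rightarrow> 'b beta" is filtermap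
  by (auto simp: eventually_filtermap filtermap_bot_iff)

text \<open>Ultrafilters on a subset \<open>S\<close> of a type are represented by the ultrafilters on
  the type that contain \<open>S\<close>.\<close>

definition beta_on :: "'a set \<Rightarrow> 'a beta set" where
  "beta_on S = {\<uu>. \<forall>\<^sub>F x in filter_of \<uu>. x \<in> S}"

definition beta_top :: "'a beta topology" where
  "beta_top = topology_generated_by (range (\<lambda>A. {\<uu>. \<forall>\<^sub>F x in filter_of \<uu>. x \<in> A}))"

text \<open>The unique continuous extension to \<open>\<beta>S\<close> of \<open>g\<close> defined on \<open>S\<close>, with values in \<open>T\<close>.\<close>

definition beta_extend :: "'a set \<Rightarrow> 'b topology \<Rightarrow> ('a \<Rightarrow> 'b) \<Rightarrow> 'a beta \<Rightarrow> 'b" where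
  "beta_extend S T g =
     (THE k. k \<in> extensional (beta_on S)
           \<and> continuous_map (subtopology beta_top (beta_on S)) T k
           \<and> (\<forall>x\<in>S. k (princ x) = g x))"

section \<open>Operations and relations and their ultrafilter extensions\<close>

text \<open>A point of \<open>Z\<^sup>n\<close> is a list of length \<open>n\<close>. Operations are extensional, so that
  \<open>ops n\<close> is in bijection with the set of all maps from \<open>Z\<^sup>n\<close> to \<open>Z\<close>.\<close>

definition tuples :: "nat \<Rightarrow> 'a list set" where
  "tuples n = {xs. length xs = n}"

definition ops :: "nat \<Rightarrow> ('a list \<Rightarrow> 'a) set" where
  "ops n = tuples n \<rightarrow>\<^sub>E UNIV"

definition rels :: "nat \<Rightarrow> 'a list set set" where
  "rels n = Pow (tuples n)"

text \<open>The iterated quantifier \<open>(\<forall>\<^sup>\<uu>\<^sup>1x\<^sub>1) \<dots> (\<forall>\<^sup>\<uu>\<^sup>nx\<^sub>n) P(x\<^sub>1,\<dots>,x\<^sub>n)\<close>.\<close>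

fun all_ultra :: "'a beta list \<Rightarrow> ('a list \<Rightarrow> bool) \<Rightarrow> bool" where
  "all_ultra [] P \<longleftrightarrow> P []"
| "all_ultra (\<uu> # \<uu>s) P \<longleftrightarrow> (\<forall>\<^sub>F x in filter_of \<uu>. all_ultra \<uu>s (\<lambda>xs. P (x # xs)))"

definition fun_ext :: "nat \<Rightarrow> ('a list \<Rightarrow> 'a) \<Rightarrow> 'a beta list \<Rightarrow> 'a beta" where
  "fun_ext n f = (\<lambda>\<uu>s\<in>tuples n.
     THE \<vv>. \<forall>A. (\<forall>\<^sub>F y in filter_of \<vv>. y \<in> A) \<longleftrightarrow> all_ultra \<uu>s (\<lambda>xs. f xs \<in> A))"

definition rel_ext :: "nat \<Rightarrow> 'a list set \<Rightarrow> 'a beta list set" where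
  "rel_ext n Q = {\<uu>s \<in> tuples n. all_ultra \<uu>s (\<lambda>xs. xs \<in> Q)}"

definition rel_star :: "nat \<Rightarrow> 'a list set \<Rightarrow> 'a beta list set" where
  "rel_star n Q = {\<uu>s \<in> tuples n. \<forall>A :: nat \<Rightarrow> 'a set.
     (\<forall>i<n. \<forall>\<^sub>F x in filter_of (\<uu>s ! i). x \<in> A i)
       \<longrightarrow> Q \<inter> {xs \<in> tuples n. \<forall>i<n. xs ! i \<in> A i} \<noteq> {}}"

lemma all_ultra_mono:
  assumes "\<And>xs. P xs \<Longrightarrow> Q xs" and "all_ultra \<uu>s P"
  shows "all_ultra \<uu>s Q"
  using assms
proof (induction \<uu>s arbitrary: P Q)
  case (Cons \<uu> \<uu>s)
  have "all_ultra \<uu>s (\<lambda>xs. Q (x # xs))" if "all_ultra \<uu>s (\<lambda>xs. P (x # xs))" for x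
    using Cons.IH[of "\<lambda>xs. P (x # xs)" "\<lambda>xs. Q (x # xs)"] Cons.prems(1) that by blast
  then show ?case using Cons.prems(2) unfolding all_ultra.simps by (rule eventually_mono[rotated])
qed simp

lemma all_ultra_conj:
  assumes "all_ultra \<uu>s P" and "all_ultra \<uu>s Q"
  shows "all_ultra \<uu>s (\<lambda>xs. P xs \<and> Q xs)"
  using assms
proof (induction \<uu>s arbitrary: P Q)
  case (Cons \<uu> \<uu>s)
  have "all_ultra \<uu>s (\<lambda>xs. P (x # xs) \<and> Q (x # xs))"
    if "all_ultra \<uu>s (\<lambda>xs. P (x # xs)) \<and> all_ultra \<uu>s (\<lambda>xs. Q (x # xs))" for x
    using Cons.IH[of "\<lambda>xs. P (x # xs)" "\<lambda>xs. Q (x # xs)"] that by blast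
  moreover have "\<forall>\<^sub>F x in filter_of \<uu>.
      all_ultra \<uu>s (\<lambda>xs. P (x # xs)) \<and> all_ultra \<uu>s (\<lambda>xs. Q (x # xs))"
    using Cons.prems unfolding all_ultra.simps by (rule eventually_conj)
  ultimately show ?case unfolding all_ultra.simps by (rule eventually_mono[rotated])
qed simp

lemma all_ultra_not: "all_ultra \<uu>s (\<lambda>xs. \<not> P xs) \<longleftrightarrow> \<not> all_ultra \<uu>s P"
proof (induction \<uu>s arbitrary: P)
  case (Cons \<uu> \<uu>s)
  have ne: "filter_of \<uu> \<noteq> bot"
    and ultra: "\<And>R. eventually R (filter_of \<uu>) \<or> eventually (\<lambda>x. \<not> R x) (filter_of \<uu>)"
    using filter_of[of \<uu>] by auto
  have "eventually (\<lambda>x. \<not> R x) (filter_of \<uu>) \<longleftrightarrow> \<not> eventually R (filter_of \<uu>)" for R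
    using ultra[of R] ne eventually_conj[of R "filter_of \<uu>" "\<lambda>x. \<not> R x"]
    by (auto simp: trivial_limit_def)
  then show ?case by (simp add: Cons.IH)
qed simp

lemma eventually_fun_ext:
  assumes "length \<uu>s = n"
  shows "(\<forall>\<^sub>F y in filter_of (fun_ext n f \<uu>s). y \<in> A) \<longleftrightarrow> all_ultra \<uu>s (\<lambda>xs. f xs \<in> A)"
proof -
  define F where "F = Abs_filter (\<lambda>P. all_ultra \<uu>s (\<lambda>xs. P (f xs)))"
  have True_\<uu>s: "all_ultra \<uu>s (\<lambda>xs. True)"
    by (induction \<uu>s) auto
  have "is_filter (\<lambda>P. all_ultra \<uu>s (\<lambda>xs. P (f xs)))"
  proof
    show "all_ultra \<uu>s (\<lambda>xs. True)" by (rule True_\<uu>s)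
  next
    fix P Q :: "'a \<Rightarrow> bool"
    assume "all_ultra \<uu>s (\<lambda>xs. P (f xs))" and "all_ultra \<uu>s (\<lambda>xs. Q (f xs))"
    then show "all_ultra \<uu>s (\<lambda>xs. P (f xs) \<and> Q (f xs))" by (rule all_ultra_conj)
  next
    fix P Q :: "'a \<Rightarrow> bool"
    assume PQ: "\<forall>x. P x \<longrightarrow> Q x" and P: "all_ultra \<uu>s (\<lambda>xs. P (f xs))"
    show "all_ultra \<uu>s (\<lambda>xs. Q (f xs))" by (rule all_ultra_mono[OF _ P]) (use PQ in blast)
  qed
  then have ev: "eventually P F \<longleftrightarrow> all_ultra \<uu>s (\<lambda>xs. P (f xs))" for P
    unfolding F_def by (rule eventually_Abs_filter)
  have "F \<noteq> bot"
    using True_\<uu>s all_ultra_not[of \<uu>s "\<lambda>_. True"] ev[of "\<lambda>_. False"]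
    by (auto simp: trivial_limit_def)
  then have F: "filter_of (Abs_beta F) = F"
    by (intro Abs_beta_inverse) (auto simp: ev all_ultra_not)
  have "\<forall>A. (\<forall>\<^sub>F y in filter_of (THE \<vv>. \<forall>A. (\<forall>\<^sub>F y in filter_of \<vv>. y \<in> A) \<longleftrightarrow> all_ultra \<uu>s (\<lambda>xs. f xs \<in> A)). y \<in> A)
            \<longleftrightarrow> all_ultra \<uu>s (\<lambda>xs. f xs \<in> A)"
  proof (rule theI[where a = "Abs_beta F"])
    show "\<forall>A. (\<forall>\<^sub>F y in filter_of (Abs_beta F). y \<in> A) \<longleftrightarrow> all_ultra \<uu>s (\<lambda>xs. f xs \<in> A)"
      by (simp add: F ev)
    fix \<vv> assume \<vv>: "\<forall>A. (\<forall>\<^sub>F y in filter_of \<vv>. y \<in> A) \<longleftrightarrow> all_ultra \<uu>s (\<lambda>xs. f xs \<in> A)"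
    have "eventually P (filter_of \<vv>) \<longleftrightarrow> eventually P F" for P
      using \<vv>[rule_format, of "Collect P"] by (simp add: ev)
    then have "filter_of \<vv> = F" by (simp add: filter_eq_iff)
    then show "\<vv> = Abs_beta F" by (metis filter_of_inverse)
  qed
  then show ?thesis using assms by (simp add: fun_ext_def tuples_def)
qed

section \<open>Right continuity, right closed and right clopen relations\<close>

text \<open>Below, \<open>A\<close> is a subset of a space \<open>T\<close> whose underlying set is the whole type.\<close>

definition RC :: "'a topology \<Rightarrow> 'a set \<Rightarrow> nat \<Rightarrow> ('a list \<Rightarrow> 'a) set" where
  "RC T A n = {f \<in> ops n. \<forall>i<n. \<forall>xs\<in>tuples n. (\<forall>j<i. xs ! j \<in> A)
     \<longrightarrow> continuous_map T T (\<lambda>z. f (xs[i := z]))}"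

definition right_closed :: "'a topology \<Rightarrow> 'a set \<Rightarrow> nat \<Rightarrow> 'a list set set" where
  "right_closed T A n = {S \<in> rels n. \<forall>i<n. \<forall>xs\<in>tuples n. (\<forall>j<i. xs ! j \<in> A)
     \<longrightarrow> closedin T {z. xs[i := z] \<in> S}}"

definition right_clopen :: "'a topology \<Rightarrow> 'a set \<Rightarrow> nat \<Rightarrow> 'a list set set" where
  "right_clopen T A n = {S \<in> rels n. \<forall>i<n. \<forall>xs\<in>tuples n. (\<forall>j<i. xs ! j \<in> A)
     \<longrightarrow> closedin T {z. xs[i := z] \<in> S} \<and> openin T {z. xs[i := z] \<in> S}}"

definition tuples_top :: "'a topology \<Rightarrow> nat \<Rightarrow> 'a list topology" where
  "tuples_top T n =
     pullback_topology (tuples n) (\<lambda>xs. \<lambda>i\<in>{..<n}. xs ! i) (product_topology (\<lambda>_. T) {..<n})"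

definition closed_rels :: "'a topology \<Rightarrow> nat \<Rightarrow> 'a list set set" where
  "closed_rels T n = {S \<in> rels n. closedin (tuples_top T n) S}"

text \<open>The spaces \<open>RC\<^sub>n\<close> and \<open>RClop\<^sub>n\<close> over \<open>\<beta>X\<close>, with pointwise convergence on \<open>X\<^sup>n\<close>;
  \<open>X\<close> is embedded in \<open>\<beta>X\<close> by \<open>princ\<close>.\<close>

definition RC_top :: "nat \<Rightarrow> ('x beta list \<Rightarrow> 'x beta) topology" where
  "RC_top n = pullback_topology (RC beta_top (range princ) n)
     (\<lambda>g. \<lambda>xs\<in>tuples n. g (map princ xs))
     (product_topology (\<lambda>_ :: 'x list. beta_top) (tuples n))"

definition RClop_top :: "nat \<Rightarrow> 'x beta list set topology" where
  "RClop_top n = pullback_topology (right_clopen beta_top (range princ) n)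
     (\<lambda>S. \<lambda>xs\<in>tuples n. map princ xs \<in> S)
     (product_topology (\<lambda>_ :: 'x list. discrete_topology (UNIV :: bool set)) (tuples n))"

section \<open>Ordinary models\<close>

text \<open>The symbols form subsets of the types \<open>'f\<close>, \<open>'r\<close>, either of which may be empty. The
  universe of a model is the whole type \<open>'a\<close>. An interpretation is only relevant on the
  symbols of the signature, and on tuples whose length is the arity of the symbol.\<close>

record ('f, 'r) signature =
  fsyms :: "'f set"
  rsyms :: "'r set"
  arF :: "'f \<Rightarrow> nat"
  arR :: "'r \<Rightarrow> nat"

record ('f, 'r, 'a) omodel =
  ofun :: "'f \<Rightarrow> 'a list \<Rightarrow> 'a"
  orel :: "'r \<Rightarrow> 'a list set"

definition is_hom ::
  "('f, 'r) signature \<Rightarrow> ('a \<Rightarrow> 'b) \<Rightarrow> ('f, 'r, 'a) omodel \<Rightarrow> ('f, 'r, 'b) omodel \<Rightarrow> bool" where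
  "is_hom L h A B \<longleftrightarrow>
     (\<forall>F\<in>fsyms L. \<forall>xs\<in>tuples (arF L F). h (ofun A F xs) = ofun B F (map h xs)) \<and>
     (\<forall>R\<in>rsyms L. \<forall>xs\<in>tuples (arR L R). xs \<in> orel A R \<longrightarrow> map h xs \<in> orel B R)"

definition tilde_model ::
  "('f, 'r) signature \<Rightarrow> ('f, 'r, 'x) omodel \<Rightarrow> ('f, 'r, 'x beta) omodel" where
  "tilde_model L A =
     \<lparr> ofun = (\<lambda>F. fun_ext (arF L F) (ofun A F)), orel = (\<lambda>R. rel_ext (arR L R) (orel A R)) \<rparr>"

definition star_model ::
  "('f, 'r) signature \<Rightarrow> ('f, 'r, 'x) omodel \<Rightarrow> ('f, 'r, 'x beta) omodel" where
  "star_model L A =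
     \<lparr> ofun = (\<lambda>F. fun_ext (arF L F) (ofun A F)), orel = (\<lambda>R. rel_star (arR L R) (orel A R)) \<rparr>"

section \<open>Generalized models in the narrow sense\<close>

text \<open>The universe of a narrow model over \<open>'x\<close> is \<open>'x beta\<close>.\<close>

record ('f, 'r, 'x) nmodel =
  nfun :: "'f \<Rightarrow> ('x list \<Rightarrow> 'x) beta"
  nrel :: "'r \<Rightarrow> 'x list set beta"

definition narrow_model :: "('f, 'r) signature \<Rightarrow> ('f, 'r, 'x) nmodel \<Rightarrow> bool" where
  "narrow_model L B \<longleftrightarrow>
     (\<forall>F\<in>fsyms L. nfun B F \<in> beta_on (ops (arF L F))) \<and> (\<forall>R\<in>rsyms L. nrel B R \<in> beta_on (rels (arR L R)))"

definition pseudo_principal :: "('f, 'r) signature \<Rightarrow> ('f, 'r, 'x) nmodel \<Rightarrow> bool" where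
  "pseudo_principal L B \<longleftrightarrow>
     (\<forall>F\<in>fsyms L. \<forall>as\<in>tuples (arF L F). beta_map (\<lambda>f. f as) (nfun B F) \<in> range princ)"

definition e_model ::
  "('f, 'r) signature \<Rightarrow> ('f, 'r, 'x) nmodel \<Rightarrow> ('f, 'r, 'x beta) omodel" where
  "e_model L B =
     \<lparr> ofun = (\<lambda>F. beta_extend (ops (arF L F)) (RC_top (arF L F)) (fun_ext (arF L F)) (nfun B F)),
       orel = (\<lambda>R. beta_extend (rels (arR L R)) (RClop_top (arR L R)) (rel_ext (arR L R)) (nrel B R)) \<rparr>"

text \<open>The submodel of \<open>e(B)\<close> on the set of principal ultrafilters, transported to the type \<open>'x\<close>.\<close>

definition principal_submodel ::
  "('f, 'r) signature \<Rightarrow> ('f, 'r, 'x) nmodel \<Rightarrow> ('f, 'r, 'x) omodel" where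
  "principal_submodel L B =
     \<lparr> ofun = (\<lambda>F. \<lambda>xs\<in>tuples (arF L F). the_inv princ (ofun (e_model L B) F (map princ xs))),
       orel = (\<lambda>R. {xs \<in> tuples (arR L R). map princ xs \<in> orel (e_model L B) R}) \<rparr>"

section \<open>Generalized models in the wide sense\<close>

text \<open>The topologies in which limits are taken are part of the model.\<close>

record ('f, 'r, 'w) wmodel =
  wfun :: "'f \<Rightarrow> ('w list \<Rightarrow> 'w) beta"
  wrel :: "'r \<Rightarrow> 'w list set beta"
  wfun_top :: "nat \<Rightarrow> ('w list \<Rightarrow> 'w) topology"
  wrel_top :: "nat \<Rightarrow> 'w list set topology"

definition wide_model :: "('f, 'r) signature \<Rightarrow> ('f, 'r, 'w) wmodel \<Rightarrow> bool" where
  "wide_model L M \<longleftrightarrow>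
     (\<forall>F\<in>fsyms L. wfun M F \<in> beta_on (ops (arF L F))) \<and> (\<forall>R\<in>rsyms L. wrel M R \<in> beta_on (rels (arR L R)))"

definition converges :: "'a topology \<Rightarrow> 'a beta \<Rightarrow> 'a \<Rightarrow> bool" where
  "converges T \<uu> l \<longleftrightarrow> limitin T (\<lambda>x. x) l (filter_of \<uu>)"

definition ulim :: "'a topology \<Rightarrow> 'a beta \<Rightarrow> 'a" where
  "ulim T \<uu> = (THE l. converges T \<uu> l)"

definition has_limit_in :: "'a topology \<Rightarrow> 'a beta \<Rightarrow> 'a set \<Rightarrow> bool" where
  "has_limit_in T \<uu> S \<longleftrightarrow> (\<exists>!l. converges T \<uu> l) \<and> ulim T \<uu> \<in> S"

definition lim_model ::
  "('f, 'r) signature \<Rightarrow> ('f, 'r, 'w) wmodel \<Rightarrow> ('f, 'r, 'w) omodel" where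
  "lim_model L M =
     \<lparr> ofun = (\<lambda>F. ulim (wfun_top M (arF L F)) (wfun M F)),
       orel = (\<lambda>R. ulim (wrel_top M (arR L R)) (wrel M R)) \<rparr>"

definition i_model ::
  "('f, 'r) signature \<Rightarrow> ('f, 'r, 'x) nmodel \<Rightarrow> ('f, 'r, 'x beta) wmodel" where
  "i_model L B =
     \<lparr> wfun = (\<lambda>F. beta_map (fun_ext (arF L F)) (nfun B F)),
       wrel = (\<lambda>R. beta_map (rel_ext (arR L R)) (nrel B R)),
       wfun_top = RC_top,
       wrel_top = RClop_top \<rparr>"

end

theory Submission
  imports Defs
begin

text \<open>A map or relation on \<open>(\<beta>X)\<^sup>n\<close> that is right continuous (right clopen) with respect to \<open>X\<close> is
  determined by its trace on \<open>X\<^sup>n\<close>: moving the arguments from \<open>X\<close> to \<open>\<beta>X\<close> one at a time, from the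
  last to the first, each step is a limit along an ultrafilter. Hence \<open>e(\<ff>)\<close> is the right
  continuous extension of \<open>(x\<^sub>1,\<dots>,x\<^sub>n) \<mapsto> {A. (\<forall>\<^sup>\<ff>f) f(x\<^sub>1,\<dots>,x\<^sub>n) \<in> A}\<close>, and \<open>e(\<rr>)\<close> is the right clopen
  extension of \<open>{(x\<^sub>1,\<dots>,x\<^sub>n). (\<forall>\<^sup>\<rr>Q) (x\<^sub>1,\<dots>,x\<^sub>n) \<in> Q}\<close>. Pseudo-principality makes the first map
  \<open>X\<close>-valued, so that \<open>e(\<BB>)\<close> is the ultrafilter extension of the principal submodel;
  continuity of \<open>e\<close> identifies it with the limit model of \<open>i(\<BB>)\<close>. Thus (ii) and (iii) concern the
  same model. From (i) to (iii), the homomorphism condition holds on \<open>X\<^sup>n\<close> and is right closed, hence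
  holds on \<open>(\<beta>X)\<^sup>n\<close>. For (iv), a point of \<open>R\<^sup>*\<close> lies in the closure of \<open>R\<close> in the product topology.\<close>

section \<open>Ultrafilters as maximal proper filters\<close>

lemma filter_of_neq_bot [simp]: "filter_of \<uu> \<noteq> bot"
  using filter_of[of \<uu>] by auto

lemma eventually_not_filter_of:
  "(\<forall>\<^sub>F x in filter_of \<uu>. \<not> P x) \<longleftrightarrow> \<not> eventually P (filter_of \<uu>)"
proof -
  have "eventually P (filter_of \<uu>) \<or> (\<forall>\<^sub>F x in filter_of \<uu>. \<not> P x)"
    using filter_of[of \<uu>] by auto
  moreover have False if "eventually P (filter_of \<uu>)" "\<forall>\<^sub>F x in filter_of \<uu>. \<not> P x"
    using eventually_conj[OF that] by (simp add: eventually_False)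
  ultimately show ?thesis by blast
qed

lemma beta_eqI:
  assumes "\<And>P. eventually P (filter_of \<uu>) \<longleftrightarrow> eventually P (filter_of \<vv>)"
  shows "\<uu> = \<vv>"
  using assms by (metis filter_eq_iff filter_of_inverse)

lemma eventually_princ [simp]: "eventually P (filter_of (princ x)) \<longleftrightarrow> P x"
  by transfer (simp add: eventually_principal)

lemma eventually_beta_map [simp]:
  "eventually P (filter_of (beta_map f \<uu>)) \<longleftrightarrow> (\<forall>\<^sub>F x in filter_of \<uu>. P (f x))"
  by transfer (simp add: eventually_filtermap)

lemma inj_princ: "inj princ"
proof (rule injI)
  fix x y :: 'a assume eq: "princ x = princ y"
  have "\<forall>\<^sub>F z in filter_of (princ x). z = y" unfolding eq by simp
  then show "x = y" by simp
qed

lemma princ_mem_beta_on_iff [simp]: "princ x \<in> beta_on S \<longleftrightarrow> x \<in> S"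
  by (simp add: beta_on_def)

section \<open>Continuous maps on \<open>\<beta>S\<close>\<close>

lemma topspace_beta_top [simp]: "topspace beta_top = UNIV"
proof -
  have "\<uu> \<in> {\<uu>. \<forall>\<^sub>F x in filter_of \<uu>. x \<in> UNIV}" for \<uu> :: "'a beta" by simp
  then show ?thesis unfolding beta_top_def topology_generated_by_topspace by blast
qed

lemma openin_beta_top_basic: "openin beta_top {\<uu>. eventually P (filter_of \<uu>)}"
  unfolding beta_top_def
  by (rule topology_generated_by_Basis, rule image_eqI[of _ _ "Collect P"]) auto

lemma closedin_beta_top_basic: "closedin beta_top {\<uu>. eventually P (filter_of \<uu>)}"
proof -
  have "UNIV - {\<uu>. eventually P (filter_of \<uu>)} = {\<uu>. \<forall>\<^sub>F x in filter_of \<uu>. \<not> P x}"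
    by (auto simp: eventually_not_filter_of)
  then show ?thesis by (simp add: closedin_def openin_beta_top_basic)
qed

text \<open>The generating sets are closed under binary intersection, so they form a base and not
  only a subbase.\<close>

lemma openin_beta_topD:
  assumes "openin beta_top W" and "\<uu> \<in> W"
  obtains P where "eventually P (filter_of \<uu>)" and "\<And>\<vv>. eventually P (filter_of \<vv>) \<Longrightarrow> \<vv> \<in> W"
proof -
  have "generate_topology_on (range (\<lambda>A. {\<uu>. \<forall>\<^sub>F x in filter_of \<uu>. x \<in> A})) W"
    using assms(1) by (simp add: beta_top_def openin_topology_generated_by_iff)
  then have "\<exists>P. eventually P (filter_of \<uu>) \<and> (\<forall>\<vv>. eventually P (filter_of \<vv>) \<longrightarrow> \<vv> \<in> W)"
    using assms(2)
  proof (induction arbitrary: \<uu>)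
    case (Int a b)
    then obtain P Q where
      "eventually P (filter_of \<uu>) \<and> (\<forall>\<vv>. eventually P (filter_of \<vv>) \<longrightarrow> \<vv> \<in> a)"
      "eventually Q (filter_of \<uu>) \<and> (\<forall>\<vv>. eventually Q (filter_of \<vv>) \<longrightarrow> \<vv> \<in> b)" by blast
    then show ?case by (intro exI[of _ "\<lambda>x. P x \<and> Q x"]) (auto simp: eventually_conj_iff)
  next
    case (UN K)
    then show ?case by (metis UnionE UnionI)
  next
    case (Basis s)
    then show ?case by blast
  qed simp
  then show thesis using that by blast
qed

lemma Hausdorff_beta_top: "Hausdorff_space beta_top"
  unfolding Hausdorff_space_def
proof (intro allI impI)
  fix \<uu> \<vv> :: "'a beta"
  assume "\<uu> \<in> topspace beta_top \<and> \<vv> \<in> topspace beta_top \<and> \<uu> \<noteq> \<vv>"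
  then obtain P where "eventually P (filter_of \<uu>) \<noteq> eventually P (filter_of \<vv>)"
    by (meson beta_eqI)
  \<comment> \<open>Either \<open>P\<close> or its negation is large for \<uu> and small for \<vv>;
    the double negation makes the second disjunct an instance of the first.\<close>
  then have "eventually P (filter_of \<uu>) \<and> (\<forall>\<^sub>F x in filter_of \<vv>. \<not> P x)
      \<or> (\<forall>\<^sub>F x in filter_of \<uu>. \<not> P x) \<and> (\<forall>\<^sub>F x in filter_of \<vv>. \<not> \<not> P x)"
    by (auto simp: eventually_not_filter_of)
  then obtain P where "eventually P (filter_of \<uu>)" "\<forall>\<^sub>F x in filter_of \<vv>. \<not> P x" by blast
  then show "\<exists>U V. openin beta_top U \<and> openin beta_top V \<and> \<uu> \<in> U \<and> \<vv> \<in> V \<and> disjnt U V"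
    using openin_beta_top_basic[of P] openin_beta_top_basic[of "\<lambda>x. \<not> P x"]
    by - (rule exI[of _ "{\<uu>. eventually P (filter_of \<uu>)}"],
        rule exI[of _ "{\<uu>. \<forall>\<^sub>F x in filter_of \<uu>. \<not> P x}"],
        simp add: disjnt_iff eventually_not_filter_of)
qed

lemma continuous_map_into_beta_top:
  fixes k :: "'b \<Rightarrow> 'a beta"
  assumes "\<And>P. openin X {x \<in> topspace X. eventually P (filter_of (k x))}"
  shows "continuous_map X beta_top k"
  unfolding beta_top_def
proof (rule continuous_on_generated_topo)
  fix U :: "'a beta set" assume "U \<in> range (\<lambda>A. {\<uu>. \<forall>\<^sub>F x in filter_of \<uu>. x \<in> A})"
  then obtain A where "U = {\<uu>. \<forall>\<^sub>F x in filter_of \<uu>. x \<in> A}" by blast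
  then have "k -` U \<inter> topspace X = {x \<in> topspace X. \<forall>\<^sub>F y in filter_of (k x). y \<in> A}" by auto
  then show "openin X (k -` U \<inter> topspace X)" using assms by simp
next
  show "k ` topspace X \<subseteq> \<Union> (range (\<lambda>A. {\<uu>. \<forall>\<^sub>F x in filter_of \<uu>. x \<in> A}))"
    using topspace_beta_top unfolding beta_top_def topology_generated_by_topspace by blast
qed

text \<open>A basic set around \<uu> contains \<open>princ x\<close> for \<uu>-almost all
  \<open>x\<close>, so \<uu> is the limit of the principal ultrafilters along itself, and
  \<open>k\<close> preserves this limit. Continuity thus becomes convergence along
  ultrafilters.\<close>

lemma limitin_beta_continuous:
  assumes "continuous_map (subtopology beta_top (beta_on S)) T k" and "\<uu> \<in> beta_on S"
  shows "limitin T (\<lambda>x. k (princ x)) (k \<uu>) (filter_of \<uu>)"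
  unfolding limitin_def
proof (intro conjI allI impI)
  show "k \<uu> \<in> topspace T"
    using continuous_map_image_subset_topspace[OF assms(1)] assms(2) by auto
  fix U assume U: "openin T U \<and> k \<uu> \<in> U"
  then have "openin (subtopology beta_top (beta_on S)) {\<vv> \<in> beta_on S. k \<vv> \<in> U}"
    using openin_continuous_map_preimage[OF assms(1), of U] by simp
  then obtain W where W: "openin beta_top W" "{\<vv> \<in> beta_on S. k \<vv> \<in> U} = W \<inter> beta_on S"
    by (auto simp: openin_subtopology)
  with U assms(2) have "\<uu> \<in> W" by blast
  from openin_beta_topD[OF W(1) this] obtain P where
    P: "eventually P (filter_of \<uu>)" and PW: "\<And>\<vv>. eventually P (filter_of \<vv>) \<Longrightarrow> \<vv> \<in> W" by blast
  have "\<forall>\<^sub>F x in filter_of \<uu>. x \<in> S" using assms(2) by (simp add: beta_on_def)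
  with P show "\<forall>\<^sub>F x in filter_of \<uu>. k (princ x) \<in> U"
  proof eventually_elim
    case (elim x)
    then have "princ x \<in> W \<inter> beta_on S" using PW by simp
    then show ?case using W(2) by blast
  qed
qed

text \<open>Resolves the definite description in \<open>beta_extend\<close>: at each \<vv> a
  competitor takes the limit along \<vv> of the same values, and limits in a Hausdorff space are
  unique.\<close>

lemma beta_extend_eq:
  assumes T: "Hausdorff_space T"
    and k: "continuous_map (subtopology beta_top (beta_on S)) T k"
    and g: "\<And>x. x \<in> S \<Longrightarrow> k (princ x) = g x"
    and \<uu>: "\<uu> \<in> beta_on S"
  shows "beta_extend S T g \<uu> = k \<uu>"
proof -
  have "beta_extend S T g = restrict k (beta_on S)"
    unfolding beta_extend_def
  proof (rule the_equality)
    show "restrict k (beta_on S) \<in> extensional (beta_on S)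
      \<and> continuous_map (subtopology beta_top (beta_on S)) T (restrict k (beta_on S))
      \<and> (\<forall>x\<in>S. restrict k (beta_on S) (princ x) = g x)"
      using continuous_map_eq[OF k, of "restrict k (beta_on S)"] g by auto
  next
    fix l assume l: "l \<in> extensional (beta_on S)
      \<and> continuous_map (subtopology beta_top (beta_on S)) T l \<and> (\<forall>x\<in>S. l (princ x) = g x)"
    show "l = restrict k (beta_on S)"
    proof (rule extensionalityI[where A = "beta_on S"])
      fix \<vv> assume v: "\<vv> \<in> beta_on S"
      then have "\<forall>\<^sub>F x in filter_of \<vv>. x \<in> S" by (simp add: beta_on_def)
      then have ev: "\<forall>\<^sub>F x in filter_of \<vv>. l (princ x) = k (princ x)"
        by eventually_elim (use l g in simp)
      have "limitin T (\<lambda>x. l (princ x)) (l \<vv>) (filter_of \<vv>)"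
        using l v by (blast intro: limitin_beta_continuous)
      then have "limitin T (\<lambda>x. k (princ x)) (l \<vv>) (filter_of \<vv>)"
        by (rule limitin_transform_eventually[OF ev])
      then have "l \<vv> = k \<vv>"
        by (rule limitin_Hausdorff_unique[OF _ limitin_beta_continuous[OF k v] _ T]) simp
      then show "l \<vv> = restrict k (beta_on S) \<vv>" using v by simp
    qed (use l in auto)
  qed
  then show ?thesis using \<uu> by simp
qed

text \<open>Meant to be used with the same \<open>k\<close> as \<open>beta_extend_eq\<close>: the
  limit of the image ultrafilter and the value of the continuous extension then coincide.\<close>

lemma ulim_beta_map:
  assumes T: "Hausdorff_space T"
    and k: "continuous_map (subtopology beta_top (beta_on S)) T k"
    and g: "\<And>x. x \<in> S \<Longrightarrow> k (princ x) = g x"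
    and \<uu>: "\<uu> \<in> beta_on S"
  shows "ulim T (beta_map g \<uu>) = k \<uu>"
proof -
  have "\<forall>\<^sub>F x in filter_of \<uu>. x \<in> S" using \<uu> by (simp add: beta_on_def)
  then have "\<forall>\<^sub>F x in filter_of \<uu>. k (princ x) = g x" by eventually_elim (rule g)
  then have "limitin T g (k \<uu>) (filter_of \<uu>)"
    by (rule limitin_transform_eventually) (rule limitin_beta_continuous[OF k \<uu>])
  then have lim: "converges T (beta_map g \<uu>) (k \<uu>)"
    by (simp add: converges_def limitin_def)
  show ?thesis unfolding ulim_def
  proof (rule the_equality[where P = "converges T (beta_map g \<uu>)", OF lim])
    show "l = k \<uu>" if "converges T (beta_map g \<uu>) l" for l
      using limitin_Hausdorff_unique[OF that[unfolded converges_def] lim[unfolded converges_def]] T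
      by simp
  qed
qed

text \<open>If no point were a limit, each would have a neighbourhood with small preimage; finitely
  many of these cover the space, so \<uu> would contain the empty set.\<close>

lemma compact_ultra_limit:
  assumes "compact_space T" and "range h \<subseteq> topspace T"
  shows "\<exists>l. limitin T h l (filter_of \<uu>)"
proof (rule ccontr)
  assume "\<nexists>l. limitin T h l (filter_of \<uu>)"
  then have "\<forall>y\<in>topspace T. \<exists>U. openin T U \<and> y \<in> U \<and> \<not> (\<forall>\<^sub>F x in filter_of \<uu>. h x \<in> U)"
    unfolding limitin_def by blast
  then obtain U where U: "\<And>y. y \<in> topspace T \<Longrightarrow> openin T (U y)"
      "\<And>y. y \<in> topspace T \<Longrightarrow> y \<in> U y"
      "\<And>y. y \<in> topspace T \<Longrightarrow> \<not> (\<forall>\<^sub>F x in filter_of \<uu>. h x \<in> U y)"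
    by metis
  have "\<exists>\<F>. finite \<F> \<and> \<F> \<subseteq> U ` topspace T \<and> topspace T \<subseteq> \<Union>\<F>"
    using assms(1) U(1,2) unfolding compact_space_alt by (smt (verit) UN_I imageE subsetI)
  then obtain \<F> where F: "finite \<F>" "\<F> \<subseteq> U ` topspace T" "topspace T \<subseteq> \<Union>\<F>" by blast
  have "\<forall>\<^sub>F x in filter_of \<uu>. \<forall>W\<in>\<F>. h x \<notin> W"
    using F(1,2) U(3) by (intro eventually_ball_finite) (auto simp: eventually_not_filter_of)
  then have "\<forall>\<^sub>F x in filter_of \<uu>. False"
    by eventually_elim (use F(3) assms(2) in blast)
  then show False by (simp add: eventually_False)
qed

lemma beta_extend_compact_Hausdorff:
  fixes h :: "'x \<Rightarrow> 'y"
  assumes "compact_space T" and "Hausdorff_space T" and h: "range h \<subseteq> topspace T"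
  shows "continuous_map beta_top T (beta_extend UNIV T h)"
    and "beta_extend UNIV T h (princ x) = h x"
proof -
  \<comment> \<open>The extension is built from ultrafilter limits, which exist by compactness and
    are unique by the Hausdorff property.\<close>
  define k where "k \<uu> = (THE l. limitin T h l (filter_of \<uu>))" for \<uu>
  have k_eqI: "k \<uu> = l" if "limitin T h l (filter_of \<uu>)" for \<uu> l
    unfolding k_def
    by (rule the_equality[where P = "\<lambda>l. limitin T h l (filter_of \<uu>)", OF that],
        rule limitin_Hausdorff_unique[OF _ that _ assms(2)]) simp_all
  have lim: "limitin T h (k \<uu>) (filter_of \<uu>)" for \<uu>
  proof -
    obtain l where "limitin T h l (filter_of \<uu>)" using compact_ultra_limit[OF assms(1) h] by blast
    then show ?thesis using k_eqI by simp
  qed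
  have k_princ: "k (princ x) = h x" for x
    using h by (intro k_eqI) (auto simp: limitin_def)
  have top: "k \<uu> \<in> topspace T" for \<uu> using lim limitin_topspace by metis
  have cont: "continuous_map beta_top T k"
    unfolding continuous_map_atin limitin_atin
  proof (intro ballI conjI allI impI)
    fix \<uu> :: "'x beta" and W
    show "k \<uu> \<in> topspace T" by (rule top)
    assume W: "openin T W \<and> k \<uu> \<in> W"
    \<comment> \<open>Values of \<open>h\<close> in \<open>V\<close> force their limit only into a
      closed superset of \<open>V\<close>; regularity supplies such a set \<open>C\<close> inside
      \<open>W\<close>.\<close>
    have "neighbourhood_base_of (closedin T) T"
      using assms by (simp add: neighbourhood_base_of_closedin compact_Hausdorff_imp_regular_space)
    then obtain V C where VC: "openin T V" "closedin T C" "k \<uu> \<in> V" "V \<subseteq> C" "C \<subseteq> W"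
      using W unfolding neighbourhood_base_of by meson
    have "\<forall>\<^sub>F x in filter_of \<uu>. h x \<in> V" using lim VC(1,3) unfolding limitin_def by blast
    moreover have "k \<vv> \<in> W" if "\<forall>\<^sub>F x in filter_of \<vv>. h x \<in> V" for \<vv>
    proof -
      have "\<forall>\<^sub>F x in filter_of \<vv>. h x \<in> C" using that by eventually_elim (use VC(4) in blast)
      then have "k \<vv> \<in> C" using limitin_closedin[OF lim VC(2)] by simp
      then show ?thesis using VC(5) by blast
    qed
    ultimately show "\<exists>U. openin beta_top U \<and> \<uu> \<in> U \<and> k ` (U - {\<uu>}) \<subseteq> W"
      by (intro exI[of _ "{\<vv>. \<forall>\<^sub>F x in filter_of \<vv>. h x \<in> V}"])
        (auto simp: openin_beta_top_basic)
  qed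
  have "beta_extend UNIV T h \<uu> = k \<uu>" for \<uu>
    by (rule beta_extend_eq[OF assms(2)])
      (auto simp: beta_on_def k_princ cont continuous_map_from_subtopology)
  then have "beta_extend UNIV T h = k" by (rule ext)
  then show "continuous_map beta_top T (beta_extend UNIV T h)" "beta_extend UNIV T h (princ x) = h x"
    using cont k_princ by simp_all
qed

section \<open>Relations and maps right continuous with respect to \<open>X\<close>\<close>

lemma mem_tuples_iff [simp]: "xs \<in> tuples n \<longleftrightarrow> length xs = n"
  by (simp add: tuples_def)

lemma all_ultra_map_princ_append:
  "all_ultra (map princ ys @ \<vv>s) P \<longleftrightarrow> all_ultra \<vv>s (\<lambda>xs. P (ys @ xs))"
  by (induction ys arbitrary: P) simp_all

lemma all_ultra_map_princ [simp]: "all_ultra (map princ ys) P \<longleftrightarrow> P ys"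
  using all_ultra_map_princ_append[of ys "[]" P] by simp

lemma all_ultra_True [simp]: "all_ultra \<uu>s (\<lambda>xs. True)"
  by (induction \<uu>s) simp_all

text \<open>The nested quantifiers generate only lists as long as \<uu>s, so the predicates may
  differ on all others.\<close>

lemma all_ultra_cong_length:
  assumes "\<And>xs. length xs = length \<uu>s \<Longrightarrow> P xs \<longleftrightarrow> Q xs"
  shows "all_ultra \<uu>s P \<longleftrightarrow> all_ultra \<uu>s Q"
  using assms
proof (induction \<uu>s arbitrary: P Q)
  case (Cons \<uu> \<uu>s)
  have "all_ultra \<uu>s (\<lambda>xs. P (x # xs)) \<longleftrightarrow> all_ultra \<uu>s (\<lambda>xs. Q (x # xs))" for x
    by (rule Cons.IH) (simp add: Cons.prems)
  then show ?case by simp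
qed simp

text \<open>\<uu> is the limit of the principal ultrafilters along \<uu>: the limit lemma is applied
  to the identity map.\<close>

lemma closedin_beta_top_mem:
  assumes "closedin beta_top K" and "\<forall>\<^sub>F x in filter_of \<uu>. princ x \<in> K"
  shows "\<uu> \<in> K"
proof -
  have "limitin beta_top (\<lambda>x. id (princ x)) (id \<uu>) (filter_of \<uu>)"
    by (rule limitin_beta_continuous[where S = UNIV])
      (auto simp: beta_on_def continuous_map_from_subtopology)
  then show ?thesis
    using assms(2) by (intro limitin_closedin[OF _ assms(1), of princ \<uu> "filter_of \<uu>"]) simp_all
qed

text \<open>Brings a section into a form that \<open>all_ultra\<close> can evaluate: a prefix of
  points of X, one varying coordinate and a fixed tail.\<close>

lemma list_update_princ_prefix:
  assumes "i < length \<uu>s" and "\<forall>j<i. \<uu>s ! j \<in> range princ"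
  obtains ys \<vv>s where "\<And>z. \<uu>s[i := z] = map princ ys @ z # \<vv>s"
proof -
  have "\<exists>ys. take i \<uu>s = map princ ys"
    unfolding ex_map_conv using assms by (auto simp: in_set_conv_nth image_iff)
  then obtain ys where "take i \<uu>s = map princ ys" by blast
  then have "\<uu>s[i := z] = map princ ys @ z # drop (Suc i) \<uu>s" for z
    using assms(1) by (simp add: upd_conv_take_nth_drop)
  then show thesis by (rule that)
qed

text \<open>The propagation principle behind the later extension arguments. Each argument is reached
  by a limit inside one section, which is closed because all earlier arguments are still
  principal.\<close>

lemma all_ultra_imp_mem_right_closed:
  assumes C: "C \<in> right_closed beta_top (range princ) n"
    and "length \<uu>s = n" and "all_ultra \<uu>s (\<lambda>xs. map princ xs \<in> C)"
  shows "\<uu>s \<in> C"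
proof -
  \<comment> \<open>Generalized to an arbitrary prefix \<open>ys\<close> of points of X: the
    induction hypothesis serves the prefix \<open>ys @ [x]\<close>, and then \<open>x\<close> tends
    to \<vv>.\<close>
  have "map princ ys @ \<vv>s \<in> C"
    if "length ys + length \<vv>s = n" "all_ultra \<vv>s (\<lambda>xs. map princ (ys @ xs) \<in> C)" for ys \<vv>s
    using that
  proof (induction \<vv>s arbitrary: ys)
    case (Cons \<vv> \<vv>s)
    let ?us = "map princ ys @ \<vv> # \<vv>s"
    have "closedin beta_top {z. ?us[length ys := z] \<in> C}"
      using C Cons.prems(1) unfolding right_closed_def by (simp add: nth_append)
    moreover have "?us[length ys := z] = map princ ys @ z # \<vv>s" for z
      by (simp add: list_update_append)
    ultimately have cl: "closedin beta_top {z. map princ ys @ z # \<vv>s \<in> C}" by simp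
    have "map princ ys @ princ x # \<vv>s \<in> C"
      if "all_ultra \<vv>s (\<lambda>xs. map princ (ys @ x # xs) \<in> C)" for x
      using Cons.IH[of "ys @ [x]"] Cons.prems(1) that by simp
    moreover have "\<forall>\<^sub>F x in filter_of \<vv>. all_ultra \<vv>s (\<lambda>xs. map princ (ys @ x # xs) \<in> C)"
      using Cons.prems(2) by simp
    ultimately have "\<forall>\<^sub>F x in filter_of \<vv>. princ x \<in> {z. map princ ys @ z # \<vv>s \<in> C}"
      by (auto elim: eventually_mono)
    then have "\<vv> \<in> {z. map princ ys @ z # \<vv>s \<in> C}" by (rule closedin_beta_top_mem[OF cl])
    then show ?case by simp
  qed simp
  from this[of "[]" \<uu>s] show ?thesis using assms by simp
qed

text \<open>The equalizer of two right continuous maps into a Hausdorff space has closed sections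
  and contains all tuples from X, so propagation fills it up.\<close>

lemma right_continuous_eqI:
  fixes p q :: "'x beta list \<Rightarrow> 'y"
  assumes T: "Hausdorff_space T"
    and p: "\<And>i \<uu>s. i < n \<Longrightarrow> length \<uu>s = n \<Longrightarrow> \<forall>j<i. \<uu>s ! j \<in> range princ \<Longrightarrow>
      continuous_map beta_top T (\<lambda>z. p (\<uu>s[i := z]))"
    and q: "\<And>i \<uu>s. i < n \<Longrightarrow> length \<uu>s = n \<Longrightarrow> \<forall>j<i. \<uu>s ! j \<in> range princ \<Longrightarrow>
      continuous_map beta_top T (\<lambda>z. q (\<uu>s[i := z]))"
    and eq: "\<And>xs. length xs = n \<Longrightarrow> p (map princ xs) = q (map princ xs)"
    and us: "length \<uu>s = n"
  shows "p \<uu>s = q \<uu>s"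
proof -
  let ?C = "{\<uu>s. length \<uu>s = n \<and> p \<uu>s = q \<uu>s}"
  have "?C \<in> right_closed beta_top (range princ) n"
    unfolding right_closed_def rels_def
    using closedin_continuous_maps_eq[OF T p q] by (auto simp: tuples_def)
  moreover have "all_ultra \<uu>s (\<lambda>xs. map princ xs \<in> ?C) \<longleftrightarrow> all_ultra \<uu>s (\<lambda>xs. True)"
    by (rule all_ultra_cong_length) (simp add: us eq)
  ultimately show ?thesis
    using all_ultra_imp_mem_right_closed[of ?C n \<uu>s] us by simp
qed

text \<open>Quantifiers over principal arguments evaluate at once, so the section is a basic clopen
  set, given by one quantifier over the \<open>i\<close>-th argument.\<close>

lemma rel_ext_right_clopen: "rel_ext n Q \<in> right_clopen beta_top (range princ) n"
  unfolding right_clopen_def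
proof (intro CollectI conjI allI ballI impI)
  show "rel_ext n Q \<in> rels n" by (auto simp: rel_ext_def rels_def)
  fix i and \<uu>s :: "'a beta list"
  assume i: "i < n" and us: "\<uu>s \<in> tuples n" and pr: "\<forall>j<i. \<uu>s ! j \<in> range princ"
  then obtain ys \<vv>s where upd: "\<And>z. \<uu>s[i := z] = map princ ys @ z # \<vv>s"
    using list_update_princ_prefix[of i \<uu>s] by auto
  have "{z. \<uu>s[i := z] \<in> rel_ext n Q}
      = {z. \<forall>\<^sub>F x in filter_of z. all_ultra \<vv>s (\<lambda>xs. ys @ x # xs \<in> Q)}"
    using us length_list_update[of \<uu>s i]
    by (auto simp: rel_ext_def all_ultra_map_princ_append upd)
  then show "closedin beta_top {z. \<uu>s[i := z] \<in> rel_ext n Q}"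
    and "openin beta_top {z. \<uu>s[i := z] \<in> rel_ext n Q}"
    by (simp_all add: closedin_beta_top_basic openin_beta_top_basic)
qed

lemma map_princ_mem_rel_ext [simp]: "map princ xs \<in> rel_ext n Q \<longleftrightarrow> length xs = n \<and> xs \<in> Q"
  by (simp add: rel_ext_def)

text \<open>Propagation applies both to \<open>C\<close> and to its complement; as
  \<open>all_ultra\<close> commutes with negation, the two implications decide membership.\<close>

lemma right_clopen_eq_rel_ext:
  assumes C: "C \<in> right_clopen beta_top (range princ) n"
  shows "C = rel_ext n {xs. map princ xs \<in> C}"
proof -
  have sub: "C \<subseteq> tuples n" using C by (auto simp: right_clopen_def rels_def)
  have rc: "C \<in> right_closed beta_top (range princ) n"
    using C by (auto simp: right_clopen_def right_closed_def)
  have rc': "tuples n - C \<in> right_closed beta_top (range princ) n"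
    unfolding right_closed_def
  proof (intro CollectI conjI allI ballI impI)
    show "tuples n - C \<in> rels n" by (auto simp: rels_def)
    fix i and \<uu>s :: "'a beta list"
    assume *: "i < n" "\<uu>s \<in> tuples n" "\<forall>j<i. \<uu>s ! j \<in> range princ"
    then have "openin beta_top {z. \<uu>s[i := z] \<in> C}" using C by (simp add: right_clopen_def)
    \<comment> \<open>Updating keeps the length, so the complement within \<open>tuples n\<close>
      has exactly the complementary sections.\<close>
    moreover have "{z. \<uu>s[i := z] \<in> tuples n - C} = topspace beta_top - {z. \<uu>s[i := z] \<in> C}"
      using * by auto
    ultimately show "closedin beta_top {z. \<uu>s[i := z] \<in> tuples n - C}"
      by (simp only: closedin_diff closedin_topspace)
  qed
  have "\<uu>s \<in> C" if "length \<uu>s = n" "all_ultra \<uu>s (\<lambda>xs. map princ xs \<in> C)" for \<uu>s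
    using all_ultra_imp_mem_right_closed[OF rc that] .
  moreover have "\<uu>s \<notin> C" if "length \<uu>s = n" "\<not> all_ultra \<uu>s (\<lambda>xs. map princ xs \<in> C)" for \<uu>s
  proof -
    have "all_ultra \<uu>s (\<lambda>xs. map princ xs \<in> tuples n - C)
        \<longleftrightarrow> all_ultra \<uu>s (\<lambda>xs. \<not> map princ xs \<in> C)"
      by (rule all_ultra_cong_length) (simp add: that(1))
    then show ?thesis
      using all_ultra_imp_mem_right_closed[OF rc' that(1)] that(2) by (simp add: all_ultra_not)
  qed
  ultimately have "\<uu>s \<in> C \<longleftrightarrow> all_ultra \<uu>s (\<lambda>xs. map princ xs \<in> C)" if "length \<uu>s = n" for \<uu>s
    using that by blast
  then show ?thesis using sub by (auto simp: rel_ext_def)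
qed

lemma fun_ext_map_princ:
  assumes "length xs = n"
  shows "fun_ext n f (map princ xs) = princ (f xs)"
proof (rule beta_eqI)
  fix P
  show "eventually P (filter_of (fun_ext n f (map princ xs))) \<longleftrightarrow> eventually P (filter_of (princ (f xs)))"
    using eventually_fun_ext[of "map princ xs" n "Collect P" f] assms by simp
qed

text \<open>Since \<open>g\<close> takes its values in \<open>\<beta>X\<close> and not only in \<open>X\<close>, this covers \<open>e(\<ff>)\<close> for every
  ultrafilter \<open>\<ff>\<close>; \<open>fun_ext\<close> is the case of principal values.\<close>

definition beta_lift :: "nat \<Rightarrow> ('x list \<Rightarrow> 'x beta) \<Rightarrow> 'x beta list \<Rightarrow> 'x beta" where
  "beta_lift n g = (\<lambda>\<uu>s\<in>tuples n.
     Abs_beta (Abs_filter (\<lambda>P. all_ultra \<uu>s (\<lambda>xs. eventually P (filter_of (g xs))))))"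

text \<open>The conjunction, monotonicity and negation laws of \<open>all_ultra\<close> make the
  family an ultrafilter, so both abstraction functions can be undone.\<close>

lemma eventually_beta_lift:
  assumes "length \<uu>s = n"
  shows "eventually P (filter_of (beta_lift n g \<uu>s)) \<longleftrightarrow>
    all_ultra \<uu>s (\<lambda>xs. eventually P (filter_of (g xs)))"
proof -
  define F where "F = Abs_filter (\<lambda>P. all_ultra \<uu>s (\<lambda>xs. eventually P (filter_of (g xs))))"
  have "is_filter (\<lambda>P. all_ultra \<uu>s (\<lambda>xs. eventually P (filter_of (g xs))))"
  proof
    fix P Q :: "'a \<Rightarrow> bool"
    show "all_ultra \<uu>s (\<lambda>xs. \<forall>\<^sub>F x in filter_of (g xs). P x \<and> Q x)"
      if "all_ultra \<uu>s (\<lambda>xs. eventually P (filter_of (g xs)))"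
        "all_ultra \<uu>s (\<lambda>xs. eventually Q (filter_of (g xs)))"
      using all_ultra_conj[OF that] by (simp add: eventually_conj_iff)
    show "all_ultra \<uu>s (\<lambda>xs. eventually Q (filter_of (g xs)))"
      if PQ: "\<forall>x. P x \<longrightarrow> Q x" and P: "all_ultra \<uu>s (\<lambda>xs. eventually P (filter_of (g xs)))"
      by (rule all_ultra_mono[OF _ P]) (use PQ in \<open>auto elim: eventually_mono\<close>)
  qed simp
  then have ev: "eventually P F \<longleftrightarrow> all_ultra \<uu>s (\<lambda>xs. eventually P (filter_of (g xs)))" for P
    unfolding F_def by (rule eventually_Abs_filter)
  have "\<not> eventually (\<lambda>x. False) F"
    unfolding ev using all_ultra_not[of \<uu>s "\<lambda>_. True"] by simp
  then have "F \<noteq> bot" by auto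
  then have "filter_of (Abs_beta F) = F"
    by (intro Abs_beta_inverse) (simp add: ev eventually_not_filter_of all_ultra_not)
  then show ?thesis using assms ev by (simp add: beta_lift_def flip: F_def)
qed

lemma beta_lift_map_princ:
  assumes "length xs = n"
  shows "beta_lift n g (map princ xs) = g xs"
  by (rule beta_eqI) (simp add: eventually_beta_lift assms)

lemma beta_lift_princ:
  assumes "\<And>xs. length xs = n \<Longrightarrow> g xs = princ (f xs)"
  shows "beta_lift n g = fun_ext n f"
proof (rule extensionalityI[where A = "tuples n"])
  fix \<uu>s :: "'a beta list" assume us: "\<uu>s \<in> tuples n"
  show "beta_lift n g \<uu>s = fun_ext n f \<uu>s"
  proof (rule beta_eqI)
    fix P
    have "all_ultra \<uu>s (\<lambda>xs. eventually P (filter_of (g xs))) \<longleftrightarrow> all_ultra \<uu>s (\<lambda>xs. f xs \<in> Collect P)"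
      by (rule all_ultra_cong_length) (use us assms in simp)
    then show "eventually P (filter_of (beta_lift n g \<uu>s)) \<longleftrightarrow> eventually P (filter_of (fun_ext n f \<uu>s))"
      using eventually_fun_ext[of \<uu>s n "Collect P" f] us by (simp add: eventually_beta_lift)
  qed
qed (simp_all add: beta_lift_def fun_ext_def)

text \<open>With the first \<open>i\<close> arguments in X, the preimage of a basic set under a
  section is again basic.\<close>

lemma beta_lift_RC: "beta_lift n g \<in> RC beta_top (range princ) n"
  unfolding RC_def
proof (intro CollectI conjI allI ballI impI)
  show "beta_lift n g \<in> ops n" by (auto simp: beta_lift_def ops_def)
  fix i and \<uu>s :: "'a beta list"
  assume i: "i < n" and us: "\<uu>s \<in> tuples n" and pr: "\<forall>j<i. \<uu>s ! j \<in> range princ"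
  then obtain ys \<vv>s where upd: "\<And>z. \<uu>s[i := z] = map princ ys @ z # \<vv>s"
    using list_update_princ_prefix[of i \<uu>s] by auto
  have "length (map princ ys @ z # \<vv>s) = n" for z
    using us upd[of z] length_list_update[of \<uu>s i z] by simp
  then have "eventually P (filter_of (beta_lift n g (\<uu>s[i := z]))) \<longleftrightarrow>
      (\<forall>\<^sub>F x in filter_of z. all_ultra \<vv>s (\<lambda>xs. eventually P (filter_of (g (ys @ x # xs)))))" for z P
    unfolding upd by (simp add: eventually_beta_lift all_ultra_map_princ_append)
  then show "continuous_map beta_top beta_top (\<lambda>z. beta_lift n g (\<uu>s[i := z]))"
    by (intro continuous_map_into_beta_top) (simp add: openin_beta_top_basic)
qed

section \<open>The spaces \<open>RC\<^sub>n\<close> and \<open>RClop\<^sub>n\<close>\<close>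

lemma Hausdorff_pullback_topology:
  assumes "Hausdorff_space T" and "inj_on f A"
  shows "Hausdorff_space (pullback_topology A f T)"
proof (rule Hausdorff_space_injective_preimage[OF assms(1)])
  have "continuous_map (pullback_topology A f T) T (id \<circ> f)"
    by (rule continuous_map_pullback) simp
  then show "continuous_map (pullback_topology A f T) T f" by simp
  show "inj_on f (topspace (pullback_topology A f T))"
    using assms(2) by (auto simp: topspace_pullback_topology intro: inj_on_subset)
qed

text \<open>The topology sees only values on tuples from X, but these determine the map by
  \<open>right_continuous_eqI\<close>; hence the restriction into the Hausdorff power is
  injective.\<close>

lemma Hausdorff_RC_top: "Hausdorff_space (RC_top n :: ('x beta list \<Rightarrow> 'x beta) topology)"
  unfolding RC_top_def
proof (rule Hausdorff_pullback_topology)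
  show "Hausdorff_space (product_topology (\<lambda>_ :: 'x list. beta_top :: 'x beta topology) (tuples n))"
    by (simp add: Hausdorff_space_product_topology Hausdorff_beta_top)
  show "inj_on (\<lambda>g. \<lambda>xs\<in>tuples n. g (map princ xs))
    (RC beta_top (range princ) n :: ('x beta list \<Rightarrow> 'x beta) set)"
  proof (rule inj_onI)
    fix p q :: "'x beta list \<Rightarrow> 'x beta"
    assume p: "p \<in> RC beta_top (range princ) n" and q: "q \<in> RC beta_top (range princ) n"
      and eq: "(\<lambda>xs\<in>tuples n. p (map princ xs)) = (\<lambda>xs\<in>tuples n. q (map princ xs))"
    have "p (map princ xs) = q (map princ xs)" if "length xs = n" for xs
      using fun_cong[OF eq, of xs] that by simp
    moreover have "continuous_map beta_top beta_top (\<lambda>z. r (\<uu>s[i := z]))"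
      if "r \<in> RC beta_top (range princ) n" "i < n" "length \<uu>s = n" "\<forall>j<i. \<uu>s ! j \<in> range princ"
      for r i and \<uu>s :: "'x beta list"
      using that by (simp add: RC_def)
    ultimately have "p \<uu>s = q \<uu>s" if "length \<uu>s = n" for \<uu>s
      using that p q by - (rule right_continuous_eqI[OF Hausdorff_beta_top, of n p q], blast+)
    moreover have "p \<in> ops n" "q \<in> ops n" using p q by (auto simp: RC_def)
    ultimately show "p = q"
      by - (rule PiE_ext[of _ "tuples n" "\<lambda>_. UNIV"], simp_all add: ops_def)
  qed
qed

text \<open>Here injectivity holds because \<open>right_clopen_eq_rel_ext\<close> rebuilds a right
  clopen relation from its trace on X.\<close>

lemma Hausdorff_RClop_top: "Hausdorff_space (RClop_top n :: 'x beta list set topology)"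
  unfolding RClop_top_def
proof (rule Hausdorff_pullback_topology)
  show "Hausdorff_space (product_topology (\<lambda>_ :: 'x list. discrete_topology (UNIV :: bool set)) (tuples n))"
    by (simp add: Hausdorff_space_product_topology)
  show "inj_on (\<lambda>S. \<lambda>xs\<in>tuples n. map princ xs \<in> S)
    (right_clopen beta_top (range princ) n :: 'x beta list set set)"
  proof (rule inj_onI)
    fix C D :: "'x beta list set"
    assume C: "C \<in> right_clopen beta_top (range princ) n" and D: "D \<in> right_clopen beta_top (range princ) n"
      and eq: "(\<lambda>xs\<in>tuples n. map princ xs \<in> C) = (\<lambda>xs\<in>tuples n. map princ xs \<in> D)"
    have iff: "map princ xs \<in> C \<longleftrightarrow> map princ xs \<in> D" if "length xs = n" for xs
      using fun_cong[OF eq, of xs] that by simp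
    have "C \<subseteq> tuples n" "D \<subseteq> tuples n" using C D by (auto simp: right_clopen_def rels_def)
    then have "{xs. map princ xs \<in> C} = {xs. map princ xs \<in> D}"
      using iff by (fastforce simp: tuples_def)
    then show "C = D" using right_clopen_eq_rel_ext[OF C] right_clopen_eq_rel_ext[OF D] by simp
  qed
qed

text \<open>The explicit form of \<open>e\<close> on ultrafilters of operations.
  \<open>RC_top\<close> tests only tuples \<open>xs\<close> from X, where the value is the image of
  \<ff> under evaluation at \<open>xs\<close>, continuous in \<ff>.\<close>

lemma continuous_map_beta_lift_RC_top:
  "continuous_map beta_top (RC_top n) (\<lambda>\<ff>. beta_lift n (\<lambda>xs. beta_map (\<lambda>f. f xs) \<ff>))"
  unfolding RC_top_def
proof (rule continuous_map_pullback')
  have "continuous_map beta_top beta_top (beta_map (\<lambda>f :: 'a list \<Rightarrow> 'a. f xs))" for xs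
    by (rule continuous_map_into_beta_top) (simp add: openin_beta_top_basic)
  then show "continuous_map beta_top (product_topology (\<lambda>_. beta_top) (tuples n))
     ((\<lambda>g. \<lambda>xs\<in>tuples n. g (map princ xs)) \<circ>
      (\<lambda>\<ff>. beta_lift n (\<lambda>xs :: 'a list. beta_map (\<lambda>f. f xs) \<ff>)))"
    by (auto simp: continuous_map_componentwise beta_lift_map_princ cong: restrict_cong)
qed (auto simp: beta_lift_RC)

text \<open>The explicit form of \<open>e\<close> on ultrafilters of relations: the trace collects
  the tuples lying in \<rr>-almost every \<open>Q\<close>.\<close>

lemma continuous_map_rel_ext_RClop_top:
  "continuous_map beta_top (RClop_top n) (\<lambda>\<rr>. rel_ext n {xs. \<forall>\<^sub>F Q in filter_of \<rr>. xs \<in> Q})"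
  unfolding RClop_top_def
proof (rule continuous_map_pullback')
  have "continuous_map beta_top (discrete_topology UNIV) (\<lambda>\<rr>. \<forall>\<^sub>F Q in filter_of \<rr>. xs \<in> Q)"
    for xs :: "'a list"
    unfolding continuous_map_def
  proof (intro conjI allI impI)
    fix U :: "bool set"
    \<comment> \<open>A set of truth values is fixed by whether it contains \<open>True\<close> and
      \<open>False\<close>; in all four cases the preimage is given by a single ultrafilter
      quantifier.\<close>
    define p q where "p \<longleftrightarrow> True \<in> U" and "q \<longleftrightarrow> False \<in> U"
    have mem: "b \<in> U \<longleftrightarrow> b \<and> p \<or> \<not> b \<and> q" for b
      by (cases b) (simp_all add: p_def q_def)
    have "{\<rr>. (\<forall>\<^sub>F Q in filter_of \<rr>. xs \<in> Q) \<in> U} = {\<rr>. \<forall>\<^sub>F Q in filter_of \<rr>. (xs \<in> Q) \<in> U}"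
      unfolding mem by (cases p; cases q) (simp_all add: eventually_not_filter_of)
    then show "openin beta_top {\<rr> \<in> topspace beta_top. (\<forall>\<^sub>F Q in filter_of \<rr>. xs \<in> Q) \<in> U}"
      by (simp add: openin_beta_top_basic)
  qed simp
  then show "continuous_map beta_top
     (product_topology (\<lambda>_. discrete_topology UNIV) (tuples n))
     ((\<lambda>S. \<lambda>xs\<in>tuples n. map princ xs \<in> S) \<circ>
      (\<lambda>\<rr>. rel_ext n {xs :: 'a list. \<forall>\<^sub>F Q in filter_of \<rr>. xs \<in> Q}))"
    by (auto simp: continuous_map_componentwise cong: restrict_cong)
qed (auto simp: rel_ext_right_clopen)

section \<open>Identification of the limit models\<close>

lemma beta_lift_princ_fun:
  "beta_lift n (\<lambda>xs. beta_map (\<lambda>f. f xs) (princ f)) = fun_ext n f"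
  by (rule beta_lift_princ) (rule beta_eqI, simp)

context
  fixes L :: "('f, 'r) signature" and B :: "('f, 'r, 'x) nmodel"
  assumes B: "narrow_model L B"
begin

text \<open>The lift is continuous in the ultrafilter and sends \<open>princ f\<close> to the
  extension of \<open>f\<close>, so uniqueness of the continuous extension applies.\<close>

lemma ofun_e_model:
  assumes "F \<in> fsyms L"
  shows "ofun (e_model L B) F = beta_lift (arF L F) (\<lambda>xs. beta_map (\<lambda>f. f xs) (nfun B F))"
  using B assms unfolding e_model_def omodel.simps
  by - (rule beta_extend_eq[OF Hausdorff_RC_top
      continuous_map_from_subtopology[OF continuous_map_beta_lift_RC_top]],
      simp_all add: narrow_model_def beta_lift_princ_fun)

lemma orel_e_model:
  assumes "R \<in> rsyms L"
  shows "orel (e_model L B) R = rel_ext (arR L R) {xs. \<forall>\<^sub>F Q in filter_of (nrel B R). xs \<in> Q}"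
  using B assms unfolding e_model_def omodel.simps
  by - (rule beta_extend_eq[OF Hausdorff_RClop_top
      continuous_map_from_subtopology[OF continuous_map_rel_ext_RClop_top]],
      simp_all add: narrow_model_def)

lemma ofun_lim_i_model:
  assumes "F \<in> fsyms L"
  shows "ofun (lim_model L (i_model L B)) F = ofun (e_model L B) F"
  using B assms unfolding ofun_e_model[OF assms] lim_model_def i_model_def omodel.simps wmodel.simps
  by - (rule ulim_beta_map[where S = "ops (arF L F)", OF Hausdorff_RC_top
      continuous_map_from_subtopology[OF continuous_map_beta_lift_RC_top]],
      simp_all add: narrow_model_def beta_lift_princ_fun)

lemma orel_lim_i_model:
  assumes "R \<in> rsyms L"
  shows "orel (lim_model L (i_model L B)) R = orel (e_model L B) R"
  using B assms unfolding orel_e_model[OF assms] lim_model_def i_model_def omodel.simps wmodel.simps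
  by - (rule ulim_beta_map[where S = "rels (arR L R)", OF Hausdorff_RClop_top
      continuous_map_from_subtopology[OF continuous_map_rel_ext_RClop_top]],
      simp_all add: narrow_model_def)

text \<open>Pseudo-principality gives the trace on X principal values \<open>princ y\<close>;
  \<open>the_inv princ\<close> in the submodel recovers \<open>y\<close>, and lifting principal
  values is \<open>fun_ext\<close>.\<close>

lemma ofun_tilde_principal_submodel:
  assumes "pseudo_principal L B" and F: "F \<in> fsyms L"
  shows "ofun (tilde_model L (principal_submodel L B)) F = ofun (e_model L B) F"
proof -
  let ?g = "\<lambda>xs. beta_map (\<lambda>f. f xs) (nfun B F)"
  have "?g xs = princ (ofun (principal_submodel L B) F xs)" if "length xs = arF L F" for xs
  proof -
    have "?g xs \<in> range princ" using assms that by (simp add: pseudo_principal_def)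
    then obtain y where "?g xs = princ y" by blast
    then show ?thesis
      using that by (simp add: principal_submodel_def ofun_e_model[OF F] beta_lift_map_princ
          the_inv_f_f[OF inj_princ])
  qed
  then have "beta_lift (arF L F) ?g = fun_ext (arF L F) (ofun (principal_submodel L B) F)"
    by (rule beta_lift_princ)
  then show ?thesis unfolding ofun_e_model[OF F] tilde_model_def omodel.simps by (rule sym)
qed

lemma orel_tilde_principal_submodel:
  assumes R: "R \<in> rsyms L"
  shows "orel (tilde_model L (principal_submodel L B)) R = orel (e_model L B) R"
proof -
  let ?Q = "{xs. \<forall>\<^sub>F Q in filter_of (nrel B R). xs \<in> Q}"
  have "orel (principal_submodel L B) R = {xs \<in> tuples (arR L R). xs \<in> ?Q}"
    by (auto simp: principal_submodel_def orel_e_model[OF R])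
  \<comment> \<open>The relation of the submodel is cut down to tuples of the right arity, which the
    iterated quantifier cannot detect.\<close>
  moreover have "all_ultra \<uu>s (\<lambda>xs. xs \<in> {xs \<in> tuples (arR L R). xs \<in> ?Q})
      \<longleftrightarrow> all_ultra \<uu>s (\<lambda>xs. xs \<in> ?Q)" if "length \<uu>s = arR L R" for \<uu>s
    by (rule all_ultra_cong_length) (simp add: that)
  ultimately show ?thesis
    unfolding orel_e_model[OF R] tilde_model_def rel_ext_def by auto
qed

end

lemma is_hom_cong:
  assumes "\<And>F. F \<in> fsyms L \<Longrightarrow> ofun A F = ofun A' F"
    and "\<And>R. R \<in> rsyms L \<Longrightarrow> orel A R = orel A' R"
  shows "is_hom L h A C \<longleftrightarrow> is_hom L h A' C"
  using assms by (simp add: is_hom_def)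

section \<open>Extending homomorphisms\<close>

text \<open>On principal tuples the extended model reproduces \<open>A\<close>, so the homomorphism
  condition can be read off there.\<close>

lemma is_hom_of_tilde:
  assumes "is_hom L h' (tilde_model L A) C" and h': "\<And>x. h' (princ x) = h x"
  shows "is_hom L h A C"
proof -
  have map_h: "map h' (map princ xs) = map h xs" for xs by (simp add: h')
  have "h (ofun A F xs) = ofun C F (map h xs)"
    if F: "F \<in> fsyms L" and xs: "xs \<in> tuples (arF L F)" for F xs
  proof -
    have "h' (fun_ext (arF L F) (ofun A F) (map princ xs)) = ofun C F (map h' (map princ xs))"
      using assms(1) F xs by (auto simp: is_hom_def tilde_model_def simp del: map_map)
    then show ?thesis using xs by (simp add: fun_ext_map_princ h' map_h del: map_map)
  qed
  moreover have "map h xs \<in> orel C R"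
    if R: "R \<in> rsyms L" and xs: "xs \<in> tuples (arR L R)" and mem: "xs \<in> orel A R" for R xs
  proof -
    have "map princ xs \<in> rel_ext (arR L R) (orel A R)" using xs mem by simp
    then have "map h' (map princ xs) \<in> orel C R"
      using assms(1) R xs by (auto simp: is_hom_def tilde_model_def simp del: map_map)
    then show ?thesis by (simp only: map_h)
  qed
  ultimately show ?thesis by (simp add: is_hom_def)
qed

text \<open>Both sides are right continuous in the tuple and agree on tuples from X, so
  \<open>right_continuous_eqI\<close> applies.\<close>

lemma fun_ext_hom:
  fixes \<uu>s :: "'a beta list"
  assumes T: "Hausdorff_space T"
    and cont: "continuous_map beta_top T h'" and h': "\<And>x. h' (princ x) = h x"
    and G: "G \<in> RC T (range h) n"
    and hom: "\<And>xs. length xs = n \<Longrightarrow> h (f xs) = G (map h xs)"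
    and us: "length \<uu>s = n"
  shows "h' (fun_ext n f \<uu>s) = G (map h' \<uu>s)"
proof (rule right_continuous_eqI[OF T, where n = n])
  fix i and \<vv>s :: "'a beta list"
  assume i: "i < n" and vs: "length \<vv>s = n" and pr: "\<forall>j<i. \<vv>s ! j \<in> range princ"
  have "fun_ext n f \<in> RC beta_top (range princ) n"
    using beta_lift_RC beta_lift_princ[of n "\<lambda>xs. princ (f xs)" f] by metis
  then have "continuous_map beta_top beta_top (\<lambda>z. fun_ext n f (\<vv>s[i := z]))"
    using i vs pr by (simp add: RC_def)
  from continuous_map_compose[OF this cont]
  show "continuous_map beta_top T (\<lambda>z. h' (fun_ext n f (\<vv>s[i := z])))" by (simp add: o_def)
  \<comment> \<open>Principal arguments go into the range of \<open>h\<close>, the set with respect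
    to which \<open>G\<close> is right continuous.\<close>
  have "map h' \<vv>s ! j \<in> range h" if "j < i" for j
    using pr that i vs h' by fastforce
  then have "continuous_map T T (\<lambda>z. G ((map h' \<vv>s)[i := z]))"
    using G i vs by (simp add: RC_def)
  from continuous_map_compose[OF cont this]
  show "continuous_map beta_top T (\<lambda>z. G (map h' (\<vv>s[i := z])))" by (simp add: o_def map_update)
next
  show "h' (fun_ext n f (map princ xs)) = G (map h' (map princ xs))" if "length xs = n" for xs
    using that hom by (simp add: fun_ext_map_princ h' o_def)
qed (rule us)

text \<open>The coordinatewise preimage of \<open>S\<close> under \<open>h'\<close> is right closed
  with respect to X, because \<open>h'\<close> is continuous and maps X into the range of
  \<open>h\<close>; propagation then applies.\<close>

lemma rel_ext_hom:
  fixes \<uu>s :: "'a beta list"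
  assumes cont: "continuous_map beta_top T h'" and h': "\<And>x. h' (princ x) = h x"
    and S: "S \<in> right_closed T (range h) n"
    and hom: "\<And>xs. length xs = n \<Longrightarrow> xs \<in> Q \<Longrightarrow> map h xs \<in> S"
    and us: "\<uu>s \<in> rel_ext n Q"
  shows "map h' \<uu>s \<in> S"
proof -
  let ?C = "{\<uu>s. map h' \<uu>s \<in> S}"
  have "?C \<in> right_closed beta_top (range princ) n"
    unfolding right_closed_def
  proof (intro CollectI conjI allI ballI impI)
    show "?C \<in> rels n" using S by (auto simp: right_closed_def rels_def)
    fix i and \<vv>s :: "'a beta list"
    assume i: "i < n" and vs: "\<vv>s \<in> tuples n" and pr: "\<forall>j<i. \<vv>s ! j \<in> range princ"
    have "map h' \<vv>s ! j \<in> range h" if "j < i" for j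
      using pr that i vs h' by fastforce
    then have "closedin T {z. (map h' \<vv>s)[i := z] \<in> S}"
      using S i vs by (simp add: right_closed_def)
    from closedin_continuous_map_preimage[OF cont this]
    show "closedin beta_top {z. \<vv>s[i := z] \<in> ?C}" by (simp add: map_update)
  qed
  moreover have len: "length \<uu>s = n" and "all_ultra \<uu>s (\<lambda>xs. xs \<in> Q)"
    using us by (auto simp: rel_ext_def)
  moreover have "all_ultra \<uu>s (\<lambda>xs. map princ xs \<in> ?C)"
  proof -
    \<comment> \<open>\<open>hom\<close> speaks only of tuples of length \<open>n\<close>, so the
      length is first added under the quantifier.\<close>
    have "all_ultra \<uu>s (\<lambda>xs. length xs = n) \<longleftrightarrow> all_ultra \<uu>s (\<lambda>xs. True)"
      by (rule all_ultra_cong_length) (simp add: len)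
    then have "all_ultra \<uu>s (\<lambda>xs. length xs = n \<and> xs \<in> Q)"
      using \<open>all_ultra \<uu>s (\<lambda>xs. xs \<in> Q)\<close> by (simp add: all_ultra_conj)
    then show ?thesis
      by (rule all_ultra_mono[rotated]) (use hom h' in \<open>auto simp: o_def\<close>)
  qed
  ultimately show ?thesis using all_ultra_imp_mem_right_closed[of ?C n \<uu>s] by simp
qed

text \<open>A box with large sides is itself large for the iterated quantifier, hence meets every
  relation that is large.\<close>

lemma rel_ext_subset_rel_star: "rel_ext n Q \<subseteq> rel_star n Q"
proof
  fix \<uu>s assume us: "\<uu>s \<in> rel_ext n Q"
  then have len: "length \<uu>s = n" and Q: "all_ultra \<uu>s (\<lambda>xs. xs \<in> Q)" by (auto simp: rel_ext_def)
  have box: "all_ultra \<vv>s (\<lambda>xs. length xs = length \<vv>s \<and> (\<forall>i<length \<vv>s. xs ! i \<in> A i))"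
    if "\<forall>i<length \<vv>s. \<forall>\<^sub>F x in filter_of (\<vv>s ! i). x \<in> A i" for \<vv>s and A :: "nat \<Rightarrow> 'a set"
    using that
  proof (induction \<vv>s arbitrary: A)
    case (Cons \<vv> \<vv>s)
    have "all_ultra \<vv>s (\<lambda>xs. length xs = length \<vv>s \<and> (\<forall>i<length \<vv>s. xs ! i \<in> A (Suc i)))"
      using Cons.prems by (intro Cons.IH) auto
    moreover have "\<forall>\<^sub>F x in filter_of \<vv>. x \<in> A 0" using Cons.prems by force
    moreover have "all_ultra \<vv>s (\<lambda>xs. length (x # xs) = length (\<vv> # \<vv>s)
        \<and> (\<forall>i<length (\<vv> # \<vv>s). (x # xs) ! i \<in> A i))"
      if "all_ultra \<vv>s (\<lambda>xs. length xs = length \<vv>s \<and> (\<forall>i<length \<vv>s. xs ! i \<in> A (Suc i)))"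
        "x \<in> A 0" for x
      by (rule all_ultra_mono[OF _ that(1)]) (simp add: All_less_Suc2 that(2))
    ultimately show ?case
      unfolding all_ultra.simps by (auto elim: eventually_mono)
  qed simp
  have "Q \<inter> {xs \<in> tuples n. \<forall>i<n. xs ! i \<in> A i} \<noteq> {}"
    if "\<forall>i<n. \<forall>\<^sub>F x in filter_of (\<uu>s ! i). x \<in> A i" for A
  proof
    assume "Q \<inter> {xs \<in> tuples n. \<forall>i<n. xs ! i \<in> A i} = {}"
    \<comment> \<open>Falsity is written \<open>\<not> True\<close> so that
      \<open>all_ultra_not\<close> refutes it.\<close>
    then have "(\<lambda>xs. xs \<in> Q \<and> length xs = n \<and> (\<forall>i<n. xs ! i \<in> A i)) = (\<lambda>xs. \<not> True)" by auto
    moreover have "all_ultra \<uu>s (\<lambda>xs. xs \<in> Q \<and> length xs = n \<and> (\<forall>i<n. xs ! i \<in> A i))"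
      using all_ultra_conj[OF Q box[of \<uu>s A]] that len by simp
    ultimately have "all_ultra \<uu>s (\<lambda>xs. \<not> True)" by (simp only:)
    then show False unfolding all_ultra_not by simp
  qed
  then show "\<uu>s \<in> rel_star n Q" using len by (simp add: rel_star_def)
qed

text \<open>If the image missed the closed set \<open>S\<close>, an open box around it would too.
  The sides of the box pull back along \<open>h\<close> to large sets, so some tuple of
  \<open>Q\<close> is mapped into the box, although \<open>hom\<close> puts its image in
  \<open>S\<close>.\<close>

lemma rel_star_hom:
  assumes top: "topspace T = UNIV"
    and cont: "continuous_map beta_top T h'" and h': "\<And>x. h' (princ x) = h x"
    and S: "S \<in> closed_rels T n"
    and hom: "\<And>xs. length xs = n \<Longrightarrow> xs \<in> Q \<Longrightarrow> map h xs \<in> S"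
    and us: "\<uu>s \<in> rel_star n Q"
  shows "map h' \<uu>s \<in> S"
proof (rule ccontr)
  assume notin: "map h' \<uu>s \<notin> S"
  have len: "length \<uu>s = n" using us by (simp add: rel_star_def)
  \<comment> \<open>Translates lists into the extensional functions on which the product topology
    lives.\<close>
  let ?r = "\<lambda>xs. \<lambda>i\<in>{..<n}. xs ! i"
  have ts: "topspace (tuples_top T n) = tuples n"
    by (auto simp: tuples_top_def topspace_pullback_topology top)
  have "openin (tuples_top T n) (tuples n - S)"
    using S by (auto simp: closed_rels_def closedin_def ts)
  then obtain W where W: "openin (product_topology (\<lambda>_. T) {..<n}) W"
    and WS: "tuples n - S = ?r -` W \<inter> tuples n"
    by (auto simp: tuples_top_def openin_pullback_topology)
  have "map h' \<uu>s \<in> ?r -` W \<inter> tuples n" using notin len by (simp flip: WS)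
  then have "?r (map h' \<uu>s) \<in> W" by simp
  then obtain U where U: "\<And>i. i < n \<Longrightarrow> openin T (U i)" "?r (map h' \<uu>s) \<in> Pi\<^sub>E {..<n} U" "Pi\<^sub>E {..<n} U \<subseteq> W"
    using W unfolding openin_product_topology_alt by (meson lessThan_iff)
  have "\<forall>\<^sub>F x in filter_of (\<uu>s ! i). x \<in> h -` U i" if "i < n" for i
  proof -
    have "h' (\<uu>s ! i) \<in> U i" using U(2) that len by (auto simp: PiE_iff)
    moreover have "limitin T (\<lambda>x. h' (princ x)) (h' (\<uu>s ! i)) (filter_of (\<uu>s ! i))"
      by (rule limitin_beta_continuous[where S = UNIV])
        (auto simp: beta_on_def cont continuous_map_from_subtopology)
    ultimately show ?thesis using U(1)[OF that] by (simp add: limitin_def h')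
  qed
  then have ev: "\<forall>i<n. \<forall>\<^sub>F x in filter_of (\<uu>s ! i). x \<in> h -` U i" by blast
  have "\<forall>A. (\<forall>i<n. \<forall>\<^sub>F x in filter_of (\<uu>s ! i). x \<in> A i)
      \<longrightarrow> Q \<inter> {xs \<in> tuples n. \<forall>i<n. xs ! i \<in> A i} \<noteq> {}"
    using us by (simp add: rel_star_def)
  from this[rule_format, OF ev[rule_format]]
  have "Q \<inter> {xs \<in> tuples n. \<forall>i<n. xs ! i \<in> h -` U i} \<noteq> {}" .
  then obtain xs where "xs \<in> Q \<inter> {xs \<in> tuples n. \<forall>i<n. xs ! i \<in> h -` U i}" by blast
  then have xs: "xs \<in> Q" "length xs = n" "\<forall>i<n. h (xs ! i) \<in> U i" by simp_all
  have "?r (map h xs) \<in> Pi\<^sub>E {..<n} U"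
    by (rule restrict_PiE_iff[THEN iffD2]) (simp add: xs)
  then have "?r (map h xs) \<in> W" using U(3) by (rule subsetD[rotated])
  then have "map h xs \<in> tuples n - S" unfolding WS using xs(2) by simp
  then show False using hom xs by simp
qed

theorem theorem48:
  fixes L :: "('f, 'r) signature"
    and BB :: "('f, 'r, 'x) nmodel"
    and AA :: "('f, 'r, 'x) omodel"
    and UU :: "('f, 'r, 'x beta) wmodel"
    and VV :: "('f, 'r, 'y) wmodel"
    and T :: "'y topology"
    and h :: "'x \<Rightarrow> 'y" and h' :: "'x beta \<Rightarrow> 'y"
  assumes "narrow_model L BB"
    and "pseudo_principal L BB"
    and "AA = principal_submodel L BB"
    and "UU = i_model L BB"
    and "topspace T = UNIV" and "compact_space T" and "Hausdorff_space T"
    and "wide_model L VV"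
    and "\<And>n. topspace (wfun_top VV n) = ops n"
    and "\<And>n. topspace (wrel_top VV n) = rels n"
    and "\<And>F. F \<in> fsyms L \<Longrightarrow> has_limit_in (wfun_top VV (arF L F)) (wfun VV F) (RC T (range h) (arF L F))"
    and "\<And>R. R \<in> rsyms L \<Longrightarrow> has_limit_in (wrel_top VV (arR L R)) (wrel VV R) (right_closed T (range h) (arR L R))"
    and "h' = beta_extend UNIV T h"
  shows "(is_hom L h AA (lim_model L VV)
            \<longleftrightarrow> is_hom L h' (lim_model L UU) (lim_model L VV))
       \<and> (is_hom L h' (lim_model L UU) (lim_model L VV)
            \<longleftrightarrow> is_hom L h' (tilde_model L AA) (lim_model L VV))
       \<and> ((\<forall>R\<in>rsyms L. has_limit_in (wrel_top VV (arR L R)) (wrel VV R) (closed_rels T (arR L R)))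
            \<longrightarrow> (is_hom L h' (tilde_model L AA) (lim_model L VV)
                  \<longleftrightarrow> is_hom L h' (star_model L AA) (lim_model L VV)))"
proof -
  let ?V = "lim_model L VV"
  have h'_cont: "continuous_map beta_top T h'" and h'_princ: "h' (princ x) = h x" for x
    using beta_extend_compact_Hausdorff[of T h] assms(5-7) by (auto simp: assms(13))
  have V_fun: "ofun ?V F \<in> RC T (range h) (arF L F)" if "F \<in> fsyms L" for F
    using assms(11)[OF that] by (simp add: has_limit_in_def lim_model_def)
  have V_rel: "orel ?V R \<in> right_closed T (range h) (arR L R)" if "R \<in> rsyms L" for R
    using assms(12)[OF that] by (simp add: has_limit_in_def lim_model_def)
  \<comment> \<open>Both models interpret every symbol as \<open>e_model\<close> does.\<close>
  have UU_tilde: "is_hom L h' (lim_model L UU) ?V \<longleftrightarrow> is_hom L h' (tilde_model L AA) ?V"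
    unfolding assms(3,4)
    by (rule is_hom_cong)
      (simp_all add: ofun_lim_i_model orel_lim_i_model ofun_tilde_principal_submodel
        orel_tilde_principal_submodel assms(1,2))
  \<comment> \<open>The clause for operations is shared by \<open>tilde_model\<close> and
    \<open>star_model\<close>.\<close>
  have fun_hom: "h' (fun_ext (arF L F) (ofun AA F) \<uu>s) = ofun ?V F (map h' \<uu>s)"
    if "is_hom L h AA ?V" "F \<in> fsyms L" "length \<uu>s = arF L F" for F \<uu>s
    using fun_ext_hom[OF assms(7) h'_cont h'_princ V_fun[OF that(2)] _ that(3)] that(1,2)
    by (simp add: is_hom_def)
  have to_tilde: "is_hom L h' (tilde_model L AA) ?V" if hom: "is_hom L h AA ?V"
  proof -
    have "map h' \<uu>s \<in> orel ?V R"
      if R: "R \<in> rsyms L" and us: "\<uu>s \<in> rel_ext (arR L R) (orel AA R)" for R \<uu>s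
      using rel_ext_hom[OF h'_cont h'_princ V_rel[OF R] _ us] hom R
      by (simp add: is_hom_def)
    then show ?thesis
      using fun_hom[OF hom] unfolding is_hom_def tilde_model_def by simp
  qed
  have tilde_iff: "is_hom L h' (tilde_model L AA) ?V \<longleftrightarrow> is_hom L h AA ?V"
    using to_tilde is_hom_of_tilde[where h = h and h' = h'] h'_princ by blast
  have star_iff: "is_hom L h' (tilde_model L AA) ?V \<longleftrightarrow> is_hom L h' (star_model L AA) ?V"
    if closed: "\<forall>R\<in>rsyms L. has_limit_in (wrel_top VV (arR L R)) (wrel VV R) (closed_rels T (arR L R))"
  proof
    assume "is_hom L h' (tilde_model L AA) ?V"
    then have hom: "is_hom L h AA ?V" by (simp add: tilde_iff)
    have "map h' \<uu>s \<in> orel ?V R"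
      if R: "R \<in> rsyms L" and us: "\<uu>s \<in> rel_star (arR L R) (orel AA R)" for R \<uu>s
    proof -
      \<comment> \<open>The limit is the same \<open>ulim\<close> as before; the extra hypothesis
        only adds that it is closed in the product.\<close>
      have "orel ?V R \<in> closed_rels T (arR L R)"
        using closed R by (simp add: has_limit_in_def lim_model_def)
      from rel_star_hom[OF assms(5) h'_cont h'_princ this _ us] show ?thesis
        using hom R by (simp add: is_hom_def)
    qed
    then show "is_hom L h' (star_model L AA) ?V"
      using fun_hom[OF hom] unfolding is_hom_def star_model_def by simp
  next
    assume "is_hom L h' (star_model L AA) ?V"
    \<comment> \<open>The operations agree and the relations of \<open>star_model\<close> are
      larger, so its condition is the stronger one.\<close>
    then show "is_hom L h' (tilde_model L AA) ?V"
      using rel_ext_subset_rel_star unfolding is_hom_def star_model_def tilde_model_def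
      by (simp add: subset_eq) blast
  qed
  show ?thesis using UU_tilde tilde_iff star_iff by blast
qed

end
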